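(* Let $p$ be an odd prime, $t$ an integer, $k$ an integer and $x\in(0,1)$. Let $F_{p,t}(z)=\sum_{j=0}^{p-1}\left(\frac{j+t}{p}\right)z^j$, let $\zeta_p=e(1/p)$ where $e(u)=e^{2\pi i u}$, write $\zeta_p^{y}:=e(y/p)$ for real $y$, and define \[ G_{p,t}(k,x)=\zeta_p^{(k-1)t}\,\frac{F_{p,t}(\zeta_p^{k+x})}{F_{p,t}(\zeta_p)}. \] Then \[ G_{p,t}(k,x)=\frac{e(x)-1}{p}\sum_{|j|<p/2}\left(\frac{k-j}{p}\right)\frac{\zeta_p^{jt}}{\zeta_p^{j+x}-1}. \]
   Context: $\left(\frac{\cdot}{p}\right)$ is the Legendre symbol modulo $p$ (equal to $0$ on multiples of $p$). The sum runs over integers $j$ with $|j|<p/2$. Note $F_{p,t}(\zeta_p)\neq 0$ (it has modulus $\sqrt p$). *)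

theory Defs
  imports Complex_Main "HOL-Number_Theory.Number_Theory"
begin

definition e :: "real \<Rightarrow> complex" where
  "e u = exp (2 * complex_of_real pi * \<i> * complex_of_real u)"

text \<open>\<open>zeta_pow p y\<close> is $\zeta_p^y$ for a real exponent $y$, with the branch fixed by
  $\zeta_p^y = e(y/p)$.\<close>

definition zeta_pow :: "nat \<Rightarrow> real \<Rightarrow> complex" where
  "zeta_pow p y = e (y / real p)"

definition F :: "nat \<Rightarrow> int \<Rightarrow> complex \<Rightarrow> complex" where
  "F p t z = (\<Sum>j=0..p-1. of_int (Legendre (int j + t) (int p)) * z ^ j)"

definition G :: "nat \<Rightarrow> int \<Rightarrow> int \<Rightarrow> real \<Rightarrow> complex" where
  "G p t k x =
     zeta_pow p (of_int ((k - 1) * t)) * (F p t (zeta_pow p (of_int k + x)) / F p t (zeta_pow p 1))"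

end

theory Submission
  imports Defs
begin

text \<open>
  Since \<open>\<zeta>\<^sub>p\<^sup>j\<^sup>+\<^sup>x\<close> has \<open>p\<close>-th power \<open>e(x)\<close>, the quotient \<open>(e(x) - 1) / (\<zeta>\<^sub>p\<^sup>j\<^sup>+\<^sup>x - 1)\<close> is a
  geometric sum over \<open>n < p\<close>. After exchanging the summations, the sum over \<open>j\<close> is a Gauss sum
  twisted by \<open>t + n\<close>, hence equals \<open>((-(t + n))/p)\<close> times the Gauss sum \<open>g\<close> up to a root of unity,
  and what remains is a multiple of \<open>F\<^sub>p\<^sub>,\<^sub>t(\<zeta>\<^sub>p\<^sup>k\<^sup>+\<^sup>x)\<close>. The constants match because
  \<open>(-1/p) g\<^sup>2 = p\<close>.
\<close>

lemma e_add: "e (u + v) = e u * e v"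
  by (simp add: e_def distrib_left exp_add)

lemma e_power: "e u ^ n = e (of_nat n * u)"
  by (simp add: e_def exp_of_nat_mult [symmetric] mult_ac)

lemma e_eq_1_iff: "e u = 1 \<longleftrightarrow> u \<in> \<int>"
proof -
  have "e u = cis (2 * pi * u)"
    by (simp add: e_def cis_conv_exp mult_ac)
  moreover have "cis (2 * pi * u) = 1 \<longleftrightarrow> u \<in> \<int>"
  proof
    assume "cis (2 * pi * u) = 1"
    then have "cos (2 * pi * u) = 1"
      by (simp add: complex_eq_iff)
    then obtain n :: int where "2 * pi * u = of_int n * 2 * pi"
      by (auto simp: cos_one_2pi_int)
    then have "u = of_int n"
      by simp
    then show "u \<in> \<int>"
      by simp
  qed simp
  ultimately show ?thesis
    by simp
qed

lemma zeta_pow_add: "zeta_pow p (u + v) = zeta_pow p u * zeta_pow p v"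
  by (simp add: zeta_pow_def add_divide_distrib e_add)

lemma zeta_pow_power: "zeta_pow p u ^ n = zeta_pow p (of_nat n * u)"
  by (simp add: zeta_pow_def e_power)

lemma zeta_pow_nonzero [simp]: "zeta_pow p u \<noteq> 0"
  by (simp add: zeta_pow_def e_def)

section \<open>Periodicity modulo \<open>p\<close> and multiplicativity of the Legendre
  symbol\<close>

lemma Legendre_cong:
  assumes "[a = b] (mod p)"
  shows "Legendre a p = Legendre b p"
proof -
  have "[a = 0] (mod p) \<longleftrightarrow> [b = 0] (mod p)"
    using assms cong_sym cong_trans by blast
  moreover have "QuadRes p a \<longleftrightarrow> QuadRes p b"
    unfolding QuadRes_def using assms cong_sym cong_trans by blast
  ultimately show ?thesis
    by (simp add: Legendre_def)
qed

context
  fixes p :: nat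
  assumes prime: "prime p" and odd: "odd p"
begin

lemma p_gt_2: "2 < p"
  using prime odd prime_ge_2_nat [of p] by (cases "p = 2") auto

lemma zeta_pow_of_int_eq_1_iff: "zeta_pow p (of_int n) = 1 \<longleftrightarrow> int p dvd n"
proof -
  have "real_of_int n / real p \<in> \<int> \<longleftrightarrow> int p dvd n"
  proof
    assume "real_of_int n / real p \<in> \<int>"
    then obtain m where "real_of_int n / real p = of_int m"
      by (elim Ints_cases)
    then have "real_of_int n = of_int (int p * m)"
      using p_gt_2 by (simp add: field_simps)
    then show "int p dvd n"
      by (metis of_int_eq_iff dvd_triv_left)
  qed (use p_gt_2 in auto)
  then show ?thesis
    by (simp add: zeta_pow_def e_eq_1_iff)
qed

lemma zeta_pow_cong:
  assumes "[a = b] (mod int p)"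
  shows "zeta_pow p (of_int a) = zeta_pow p (of_int b)"
proof -
  have "zeta_pow p (of_int a) = zeta_pow p (of_int (a - b)) * zeta_pow p (of_int b)"
    by (simp flip: zeta_pow_add)
  also have "zeta_pow p (of_int (a - b)) = 1"
    using assms by (simp add: zeta_pow_of_int_eq_1_iff cong_iff_dvd_diff del: of_int_diff)
  finally show ?thesis
    by simp
qed

text \<open>Euler's criterion gives the identity modulo \<open>p\<close>. Both sides lie in {-1, 0,
  1}, so they differ by at most 2, which is less than \<open>p\<close>, and the congruence is an
  equality.\<close>

lemma Legendre_mult:
  "Legendre (a * b) (int p) = Legendre a (int p) * Legendre b (int p)"
proof -
  let ?L = "\<lambda>a. Legendre a (int p)"
  have euler: "[?L c = c ^ ((p - 1) div 2)] (mod int p)" for c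
    using euler_criterion [OF prime p_gt_2, of c] .
  have "[?L (a * b) = ?L a * ?L b] (mod int p)"
    using euler [of "a * b"] cong_mult [OF euler [of a] euler [of b]]
    by (metis power_mult_distrib cong_sym cong_trans)
  then have "int p dvd ?L (a * b) - ?L a * ?L b"
    by (simp add: cong_iff_dvd_diff)
  moreover have "\<bar>?L (a * b) - ?L a * ?L b\<bar> < int p"
    using p_gt_2 by (auto simp: Legendre_def)
  ultimately show ?thesis
    using dvd_imp_le_int [of "?L (a * b) - ?L a * ?L b" "int p"] by force
qed

lemma Legendre_eq_0_iff: "Legendre a (int p) = 0 \<longleftrightarrow> int p dvd a"
  by (simp add: Legendre_def cong_0_iff)

lemma Legendre_square:
  "Legendre a (int p) * Legendre a (int p) = (if int p dvd a then 0 else 1)"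
  by (simp add: Legendre_def cong_0_iff)

section \<open>Substitutions in sums over complete residue systems\<close>

text \<open>A map that is injective modulo \<open>p\<close> on a set of \<open>p\<close> elements
  hits every residue class exactly once. This covers the scalings, shifts and reflections used
  below, as well as summation ranges other than \<open>{0..<int p}\<close>.\<close>

lemma sum_complete_residues:
  fixes f :: "int \<Rightarrow> 'a :: comm_monoid_add"
  assumes "\<And>a b. [a = b] (mod int p) \<Longrightarrow> f a = f b"
    and "finite A" and "card A = p"
    and "\<And>i j. i \<in> A \<Longrightarrow> j \<in> A \<Longrightarrow> [\<phi> i = \<phi> j] (mod int p) \<Longrightarrow> i = j"
  shows "(\<Sum>j\<in>A. f (\<phi> j)) = (\<Sum>m\<in>{0..<int p}. f m)"
proof -
  have inj: "inj_on (\<lambda>j. \<phi> j mod int p) A"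
    using assms(4) by (auto simp: inj_on_def cong_def)
  have sub: "(\<lambda>j. \<phi> j mod int p) ` A \<subseteq> {0..<int p}"
    using p_gt_2 by auto
  have "(\<lambda>j. \<phi> j mod int p) ` A = {0..<int p}"
    using sub by (rule card_subset_eq [rotated]) (use inj assms(3) in \<open>auto simp: card_image\<close>)
  then have "(\<Sum>m\<in>{0..<int p}. f m) = (\<Sum>j\<in>A. f (\<phi> j mod int p))"
    using sum.reindex [OF inj, of f] by simp
  also have "\<dots> = (\<Sum>j\<in>A. f (\<phi> j))"
    by (intro sum.cong refl assms(1)) (simp add: cong_def)
  finally show ?thesis
    by simp
qed

lemma cong_imp_eq_if_small:
  assumes "[i = j] (mod int p)" and "\<bar>i - j\<bar> < int p"
  shows "i = j"
  using assms dvd_imp_le_int [of "i - j" "int p"] by (force simp: cong_iff_dvd_diff)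

lemma sum_residues_mult:
  fixes f :: "int \<Rightarrow> 'a :: comm_monoid_add"
  assumes "\<And>a b. [a = b] (mod int p) \<Longrightarrow> f a = f b"
    and "\<not> int p dvd c"
  shows "(\<Sum>m\<in>{0..<int p}. f (c * m)) = (\<Sum>m\<in>{0..<int p}. f m)"
proof (rule sum_complete_residues [OF assms(1)])
  fix i j
  assume "i \<in> {0..<int p}" "j \<in> {0..<int p}" "[c * i = c * j] (mod int p)"
  moreover have "coprime c (int p)"
    using prime assms(2) prime_imp_coprime [of "int p" c] by (simp add: coprime_commute)
  ultimately show "i = j"
    by (intro cong_imp_eq_if_small) (auto simp: cong_mult_lcancel)
qed auto

section \<open>Vanishing of complete character sums\<close>

text \<open>Otherwise squaring would be surjective on the residues modulo \<open>p\<close>, hence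
  injective by finiteness; but 1 and -1 have the same square.\<close>

lemma exists_nonresidue: "\<exists>c. Legendre c (int p) = -1"
proof (rule ccontr)
  assume no: "\<nexists>c. Legendre c (int p) = -1"
  let ?q = "\<lambda>y. y\<^sup>2 mod int p"
  have "{0..<int p} \<subseteq> ?q ` {0..<int p}"
  proof
    fix b
    assume b: "b \<in> {0..<int p}"
    have "\<exists>y. [y\<^sup>2 = b] (mod int p)"
    proof (cases "int p dvd b")
      case True
      then have "[0\<^sup>2 = b] (mod int p)"
        by (simp add: cong_0_iff cong_sym)
      then show ?thesis ..
    next
      case False
      then have "QuadRes (int p) b"
        using no by (metis Legendre_def cong_0_iff)
      then show ?thesis
        by (simp add: QuadRes_def)
    qed
    then obtain y where "[y\<^sup>2 = b] (mod int p)" ..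
    then have "?q (y mod int p) = b"
      using b by (simp add: cong_def power_mod)
    then show "b \<in> ?q ` {0..<int p}"
      using p_gt_2 by (intro image_eqI [of _ _ "y mod int p"]) auto
  qed
  then have "card {0..<int p} \<le> card (?q ` {0..<int p})"
    by (intro card_mono) auto
  moreover have "card (?q ` {0..<int p}) \<le> card {0..<int p}"
    by (intro card_image_le) auto
  ultimately have "inj_on ?q {0..<int p}"
    by (intro eq_card_imp_inj_on) auto
  moreover have "?q 1 = ?q (int p - 1)"
  proof -
    have "(int p - 1)\<^sup>2 = 1 + int p * (int p - 2)"
      by (simp add: power2_eq_square algebra_simps)
    then show ?thesis
      by simp
  qed
  \<comment> \<open>The two residues are distinct because \<open>p\<close> exceeds 2.\<close>
  ultimately have "1 = int p - 1"
    by (rule inj_onD) (use p_gt_2 in auto)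
  then show False
    using p_gt_2 by simp
qed

text \<open>Scaling the variable by a nonresidue permutes the residues and flips every sign, so the
  sum equals its own negative.\<close>

lemma sum_Legendre: "(\<Sum>m\<in>{0..<int p}. Legendre m (int p)) = 0"
proof -
  obtain c where c: "Legendre c (int p) = -1"
    using exists_nonresidue ..
  then have "\<not> int p dvd c"
    by (metis Legendre_eq_0_iff zero_neq_neg_one)
  then have "(\<Sum>m\<in>{0..<int p}. Legendre (c * m) (int p)) = (\<Sum>m\<in>{0..<int p}. Legendre m (int p))"
    by (intro sum_residues_mult Legendre_cong)
  then show ?thesis
    by (simp add: Legendre_mult c sum_negf)
qed

text \<open>Orthogonality of additive characters: a geometric sum whose ratio is a
  \<open>p\<close>-th root of unity, equal to 1 exactly when \<open>p\<close> divides
  \<open>d\<close>.\<close>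

lemma sum_zeta_pow:
  "(\<Sum>m\<in>{0..<int p}. zeta_pow p (of_int (m * d))) = (if int p dvd d then of_nat p else 0)"
proof (cases "int p dvd d")
  case True
  then have "zeta_pow p (of_int (m * d)) = 1" for m
    by (simp only: zeta_pow_of_int_eq_1_iff dvd_mult)
  then show ?thesis
    using True by simp
next
  case False
  let ?w = "zeta_pow p (of_int d)"
  have "?w ^ p = zeta_pow p (of_int (int p * d))"
    by (simp add: zeta_pow_power)
  also have "\<dots> = 1"
    by (simp only: zeta_pow_of_int_eq_1_iff dvd_triv_left)
  finally have "?w ^ p = 1" .
  moreover have "?w \<noteq> 1"
    using False by (simp add: zeta_pow_of_int_eq_1_iff)
  moreover have "(\<Sum>m\<in>{0..<int p}. zeta_pow p (of_int (m * d))) = (\<Sum>m<p. ?w ^ m)"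
    by (rule sum.reindex_bij_witness [of _ int nat]) (auto simp: zeta_pow_power)
  ultimately show ?thesis
    using False by (simp add: geometric_sum)
qed

section \<open>Quadratic Gauss sums\<close>

definition gauss_sum :: "int \<Rightarrow> complex" where
  "gauss_sum a = (\<Sum>m\<in>{0..<int p}. of_int (Legendre m (int p)) * zeta_pow p (of_int (a * m)))"

text \<open>If \<open>p\<close> divides \<open>a\<close>, the additive character is trivial and
  \<open>sum_Legendre\<close> gives 0. Otherwise replacing \<open>m\<close> by \<open>a * m\<close>
  in \<open>gauss_sum 1\<close> pulls out the symbol of \<open>a\<close>, whose square is 1.\<close>

lemma gauss_sum_twist: "gauss_sum a = of_int (Legendre a (int p)) * gauss_sum 1"
proof (cases "int p dvd a")
  case True
  then have "zeta_pow p (of_int (a * m)) = 1" for m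
    by (simp only: zeta_pow_of_int_eq_1_iff dvd_mult2)
  then have "gauss_sum a = of_int (\<Sum>m\<in>{0..<int p}. Legendre m (int p))"
    by (simp add: gauss_sum_def)
  then show ?thesis
    using True Legendre_eq_0_iff [of a] by (simp add: sum_Legendre del: of_int_sum)
next
  case False
  let ?f = "\<lambda>m. of_int (Legendre m (int p)) * zeta_pow p (of_int m)"
  have "of_int (Legendre a (int p)) * gauss_sum a = (\<Sum>m\<in>{0..<int p}. ?f (a * m))"
    by (simp add: gauss_sum_def Legendre_mult sum_distrib_left mult_ac)
  also have "\<dots> = (\<Sum>m\<in>{0..<int p}. ?f m)"
    using False by (intro sum_residues_mult) (metis Legendre_cong zeta_pow_cong)
  also have "\<dots> = gauss_sum 1"
    by (simp add: gauss_sum_def)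
  finally have "of_int (Legendre a (int p) * Legendre a (int p)) * gauss_sum a =
      of_int (Legendre a (int p)) * gauss_sum 1"
    by (simp add: mult.assoc)
  then show ?thesis
    using False by (simp only: Legendre_square) simp
qed

text \<open>Parseval: evaluate \<open>\<Sum>\<^sub>a g(a) g(-a)\<close> once by the twisting formula and once by
  orthogonality of the additive characters.\<close>

lemma gauss_sum_square: "of_int (Legendre (-1) (int p)) * gauss_sum 1 ^ 2 = of_nat p"
proof -
  let ?R = "{0..<int p}" and ?L = "\<lambda>a. Legendre a (int p)"
  let ?z = "\<lambda>a. zeta_pow p (of_int a)"
  have LL: "(\<Sum>a\<in>?R. ?L a * ?L a) = int p - 1"
  proof -
    have "(\<Sum>a\<in>?R. ?L a * ?L a) = (\<Sum>a\<in>?R. if a = 0 then 0 else 1)"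
      by (intro sum.cong refl) (auto simp: Legendre_square zdvd_not_zless)
    also have "\<dots> = (\<Sum>a\<in>?R - {0}. 1)"
      by (intro sum.mono_neutral_cong_right) auto
    also have "\<dots> = int p - 1"
      using p_gt_2 by (simp add: card_Diff_singleton)
    finally show ?thesis .
  qed
  have "(\<Sum>a\<in>?R. gauss_sum a * gauss_sum (- a)) =
      (\<Sum>a\<in>?R. of_int (?L a * ?L a) * (of_int (?L (-1)) * gauss_sum 1 ^ 2))"
  proof (rule sum.cong [OF refl])
    fix a
    have "?L (- a) = ?L (-1) * ?L a"
      using Legendre_mult [of "-1" a] by simp
    then show "gauss_sum a * gauss_sum (- a) =
        of_int (?L a * ?L a) * (of_int (?L (-1)) * gauss_sum 1 ^ 2)"
      by (subst (1 2) gauss_sum_twist) (simp add: power2_eq_square)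
  qed
  also have "\<dots> = of_int (\<Sum>a\<in>?R. ?L a * ?L a) * (of_int (?L (-1)) * gauss_sum 1 ^ 2)"
    by (simp only: of_int_sum sum_distrib_right)
  also have "\<dots> = (of_nat p - 1) * (of_int (?L (-1)) * gauss_sum 1 ^ 2)"
    by (simp only: LL) simp
  finally have 1: "(\<Sum>a\<in>?R. gauss_sum a * gauss_sum (- a)) =
      (of_nat p - 1) * (of_int (?L (-1)) * gauss_sum 1 ^ 2)" .

  have "(\<Sum>a\<in>?R. gauss_sum a * gauss_sum (- a)) =
      (\<Sum>a\<in>?R. \<Sum>m\<in>?R. \<Sum>n\<in>?R. of_int (?L m * ?L n) * ?z (a * (m - n)))"
  proof (intro sum.cong refl)
    fix a
    have "?z (a * (m - n)) = ?z (a * m) * ?z (- a * n)" for m n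
      by (simp add: algebra_simps flip: zeta_pow_add)
    then show "gauss_sum a * gauss_sum (- a) =
        (\<Sum>m\<in>?R. \<Sum>n\<in>?R. of_int (?L m * ?L n) * ?z (a * (m - n)))"
      unfolding gauss_sum_def sum_product by (simp only: of_int_mult mult_ac)
  qed
  \<comment> \<open>The sum over \<open>a\<close> moves innermost, where orthogonality leaves only
    the diagonal \<open>m = n\<close>.\<close>
  also have "\<dots> = (\<Sum>m\<in>?R. \<Sum>n\<in>?R. \<Sum>a\<in>?R. of_int (?L m * ?L n) * ?z (a * (m - n)))"
    by (subst sum.swap) (intro sum.cong refl sum.swap)
  also have "\<dots> = (\<Sum>m\<in>?R. \<Sum>n\<in>?R. of_int (?L m * ?L n) * (if int p dvd m - n then of_nat p else 0))"
    by (simp only: sum_zeta_pow flip: sum_distrib_left)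
  also have "\<dots> = (\<Sum>m\<in>?R. \<Sum>n\<in>?R. if m = n then of_int (?L m * ?L m) * of_nat p else 0)"
  proof (intro sum.cong refl)
    fix m n
    assume "m \<in> ?R" "n \<in> ?R"
    then have "int p dvd m - n \<longleftrightarrow> m = n"
      using cong_imp_eq_if_small [of m n] by (auto simp: cong_iff_dvd_diff)
    then show "of_int (?L m * ?L n) * (if int p dvd m - n then of_nat p else 0) =
        (if m = n then of_int (?L m * ?L m) * of_nat p else 0)"
      by simp
  qed
  also have "\<dots> = (\<Sum>m\<in>?R. of_int (?L m * ?L m) * of_nat p)"
    by (intro sum.cong refl) (simp add: sum.delta')
  also have "\<dots> = of_int (\<Sum>m\<in>?R. ?L m * ?L m) * of_nat p"
    by (simp only: of_int_sum sum_distrib_right)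
  also have "\<dots> = (of_nat p - 1) * of_nat p"
    by (simp only: LL) simp
  finally have "(of_nat p - 1) * (of_int (?L (-1)) * gauss_sum 1 ^ 2) =
      (of_nat p - 1) * (of_nat p :: complex)"
    using 1 by simp
  moreover have "(of_nat p - 1 :: complex) \<noteq> 0"
    using p_gt_2 by (simp add: of_nat_eq_1_iff)
  ultimately show ?thesis
    using mult_left_cancel by blast
qed

lemma gauss_sum_nonzero: "gauss_sum 1 \<noteq> 0"
  using gauss_sum_square p_gt_2 by auto

section \<open>Reduction of both sides of the identity to Gauss sums\<close>

lemma F_zeta: "F p t (zeta_pow p 1) = zeta_pow p (of_int (- t)) * gauss_sum 1"
proof -
  let ?f = "\<lambda>m. of_int (Legendre m (int p)) * zeta_pow p (of_int m)"
  have "F p t (zeta_pow p 1) =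
      (\<Sum>m\<in>{0..<int p}. of_int (Legendre (m + t) (int p)) * zeta_pow p (of_int m))"
    unfolding F_def using p_gt_2
    by (intro sum.reindex_bij_witness [of _ nat int]) (auto simp: zeta_pow_power)
  also have "\<dots> = (\<Sum>m\<in>{0..<int p}. zeta_pow p (of_int (- t)) * ?f (m + t))"
    by (intro sum.cong refl) (simp add: algebra_simps flip: zeta_pow_add)
  also have "\<dots> = zeta_pow p (of_int (- t)) * (\<Sum>m\<in>{0..<int p}. ?f (m + t))"
    by (simp only: sum_distrib_left)
  also have "(\<Sum>m\<in>{0..<int p}. ?f (m + t)) = (\<Sum>m\<in>{0..<int p}. ?f m)"
  proof (rule sum_complete_residues)
    show "i = j" if "i \<in> {0..<int p}" "j \<in> {0..<int p}" "[i + t = j + t] (mod int p)" for i j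
      using that by (intro cong_imp_eq_if_small) (auto simp: cong_add_rcancel)
    show "?f a = ?f b" if "[a = b] (mod int p)" for a b
      using Legendre_cong [OF that] zeta_pow_cong [OF that] by simp
  qed simp_all
  finally show ?thesis
    by (simp add: gauss_sum_def)
qed

text \<open>Substituting \<open>m = k - j\<close> splits the character into a constant factor at
  \<open>k\<close> and the character with frequency \<open>- s\<close>.\<close>

lemma sum_shifted_Legendre:
  "(\<Sum>j | \<bar>real_of_int j\<bar> < real p / 2. of_int (Legendre (k - j) (int p)) * zeta_pow p (of_int (j * s))) =
    zeta_pow p (of_int (k * s)) * gauss_sum (- s)"
proof -
  let ?f = "\<lambda>m. of_int (Legendre m (int p)) * zeta_pow p (of_int (- s * m))"
  obtain h where h: "p = 2 * h + 1"
    using odd by (elim oddE)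
  \<comment> \<open>Since \<open>p\<close> is odd, the symmetric range has exactly
    \<open>2 * h + 1 = p\<close> elements, as a complete residue system requires.\<close>
  have A: "{j. \<bar>real_of_int j\<bar> < real p / 2} = {- int h..int h}"
    using h by (auto simp: abs_less_iff)
  have "(\<Sum>j | \<bar>real_of_int j\<bar> < real p / 2. of_int (Legendre (k - j) (int p)) * zeta_pow p (of_int (j * s))) =
      (\<Sum>j\<in>{- int h..int h}. zeta_pow p (of_int (k * s)) * ?f (k - j))"
    unfolding A by (intro sum.cong refl) (simp add: algebra_simps flip: zeta_pow_add)
  also have "\<dots> = zeta_pow p (of_int (k * s)) * (\<Sum>j\<in>{- int h..int h}. ?f (k - j))"
    by (simp only: sum_distrib_left)
  also have "(\<Sum>j\<in>{- int h..int h}. ?f (k - j)) = (\<Sum>m\<in>{0..<int p}. ?f m)"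
  proof (rule sum_complete_residues)
    show "?f a = ?f b" if "[a = b] (mod int p)" for a b
      using Legendre_cong [OF that] zeta_pow_cong [OF cong_scalar_left [OF that]] by metis
    show "i = j"
      if "i \<in> {- int h..int h}" "j \<in> {- int h..int h}" "[k - i = k - j] (mod int p)" for i j
    proof (rule cong_imp_eq_if_small)
      have "[k - (k - i) = k - (k - j)] (mod int p)"
        by (rule cong_diff [OF cong_refl that(3)])
      then show "[i = j] (mod int p)"
        by simp
      show "\<bar>i - j\<bar> < int p"
        using that h by auto
    qed
  qed (use h in auto)
  finally show ?thesis
    by (simp add: gauss_sum_def)
qed

text \<open>The ratio \<open>?w\<close> satisfies \<open>?w ^ p = e x\<close>, and
  \<open>e x\<close> differs from 1 because \<open>x\<close> is not an integer, so the denominator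
  is nonzero. Each power is split so that \<open>j\<close> enters only through an additive
  character.\<close>

lemma geometric_sum_zeta_pow:
  assumes "x \<in> {0<..<1}"
  shows "(e x - 1) / (zeta_pow p (of_int j + x) - 1) =
    (\<Sum>n<p. zeta_pow p (of_int (j * int n)) * zeta_pow p (of_nat n * x))"
proof -
  let ?w = "zeta_pow p (of_int j + x)"
  have "?w ^ p = e (of_int j + x)"
    using p_gt_2 by (simp add: zeta_pow_def e_power)
  also have "\<dots> = e x"
    using e_eq_1_iff [of "of_int j"] by (simp add: e_add)
  finally have wp: "?w ^ p = e x" .
  have "x \<notin> \<int>"
  proof
    assume "x \<in> \<int>"
    then obtain m where "x = of_int m"
      by (elim Ints_cases)
    then have "0 < m" and "m < 1"
      using assms by auto
    then show False
      by simp
  qed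
  then have "?w \<noteq> 1"
    using wp e_eq_1_iff [of x] by auto
  then have "(e x - 1) / (?w - 1) = (\<Sum>n<p. ?w ^ n)"
    by (simp add: geometric_sum wp)
  also have "\<dots> = (\<Sum>n<p. zeta_pow p (of_int (j * int n)) * zeta_pow p (of_nat n * x))"
    by (simp add: zeta_pow_power algebra_simps flip: zeta_pow_add)
  finally show ?thesis .
qed

lemma sum_eq_F:
  assumes "x \<in> {0<..<1}"
  shows "(\<Sum>j | \<bar>real_of_int j\<bar> < real p / 2. of_int (Legendre (k - j) (int p)) *
       (zeta_pow p (of_int (j * t)) * ((e x - 1) / (zeta_pow p (of_int j + x) - 1)))) =
    of_int (Legendre (-1) (int p)) * gauss_sum 1 * zeta_pow p (of_int (k * t)) *
      F p t (zeta_pow p (of_int k + x))"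
proof -
  let ?L = "\<lambda>a. of_int (Legendre a (int p)) :: complex"
  let ?z = "\<lambda>a. zeta_pow p (of_int a)"
  let ?A = "{j. \<bar>real_of_int j\<bar> < real p / 2}"
  have "(\<Sum>j\<in>?A. ?L (k - j) * (?z (j * t) * ((e x - 1) / (zeta_pow p (of_int j + x) - 1)))) =
      (\<Sum>j\<in>?A. \<Sum>n<p. zeta_pow p (of_nat n * x) * (?L (k - j) * ?z (j * (t + int n))))"
    unfolding geometric_sum_zeta_pow [OF assms] sum_distrib_left
    by (intro sum.cong refl) (simp add: distrib_left zeta_pow_add mult_ac)
  also have "\<dots> = (\<Sum>n<p. zeta_pow p (of_nat n * x) * (\<Sum>j\<in>?A. ?L (k - j) * ?z (j * (t + int n))))"
    by (subst sum.swap) (simp only: sum_distrib_left)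
  \<comment> \<open>The twisting rule is restricted to negated arguments, since in general form it
    would rewrite \<open>gauss_sum 1\<close> forever.\<close>
  also have "\<dots> = (\<Sum>n<p. zeta_pow p (of_nat n * x) *
      (?z (k * (t + int n)) * (?L (- (t + int n)) * gauss_sum 1)))"
    by (simp only: sum_shifted_Legendre gauss_sum_twist [of "- _"])
  \<comment> \<open>The symbol of -1 splits off, and the powers with exponents \<open>n * x\<close>
    and \<open>k * n\<close> combine into the \<open>n\<close>-th power of the argument of
    \<open>F\<close>.\<close>
  also have "\<dots> = (\<Sum>n<p. ?L (-1) * gauss_sum 1 * ?z (k * t) *
      (?L (int n + t) * zeta_pow p (of_int k + x) ^ n))"
  proof (intro sum.cong refl)
    fix n
    have "?L (- (t + int n)) = ?L (-1) * ?L (int n + t)"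
      using Legendre_mult [of "-1" "int n + t"] by (simp add: add.commute)
    moreover have "zeta_pow p (of_nat n * x) * ?z (k * (t + int n)) =
        ?z (k * t) * zeta_pow p (of_int k + x) ^ n"
      by (simp add: zeta_pow_power algebra_simps flip: zeta_pow_add)
    ultimately show "zeta_pow p (of_nat n * x) *
        (?z (k * (t + int n)) * (?L (- (t + int n)) * gauss_sum 1)) =
        ?L (-1) * gauss_sum 1 * ?z (k * t) * (?L (int n + t) * zeta_pow p (of_int k + x) ^ n)"
      by (simp only: mult.assoc [symmetric]) (simp only: mult_ac)
  qed
  also have "\<dots> = ?L (-1) * gauss_sum 1 * ?z (k * t) * F p t (zeta_pow p (of_int k + x))"
  proof -
    have "{0..p - 1} = {..<p}"
      using p_gt_2 by auto
    then show ?thesis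
      by (simp only: F_def sum_distrib_left)
  qed
  finally show ?thesis .
qed

text \<open>By \<open>F_zeta\<close> the denominator contributes the exponent \<open>- t\<close>;
  dividing by it turns \<open>(k - 1) * t\<close> into \<open>k * t\<close>.\<close>

lemma G_eq:
  "G p t k x = zeta_pow p (of_int (k * t)) * F p t (zeta_pow p (of_int k + x)) / gauss_sum 1"
proof -
  have "zeta_pow p (of_int (k * t)) = zeta_pow p (of_int ((k - 1) * t)) * zeta_pow p (of_int t)"
    by (simp add: algebra_simps flip: zeta_pow_add)
  moreover have "zeta_pow p (of_int (- t)) * zeta_pow p (of_int t) = 1"
    using zeta_pow_of_int_eq_1_iff [of 0] by (simp flip: zeta_pow_add)
  ultimately show ?thesis
    using gauss_sum_nonzero by (simp add: G_def F_zeta field_simps)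
qed

end

theorem theorem2p3:
  fixes p :: nat and t k :: int and x :: real
  assumes "prime p" and "odd p"
    and "x \<in> {0<..<1}"
  shows "G p t k x =
    (e x - 1) / of_nat p *
      (\<Sum>j | \<bar>real_of_int j\<bar> < real p / 2.
         of_int (Legendre (k - j) (int p)) *
           (zeta_pow p (of_int (j * t)) / (zeta_pow p (of_int j + x) - 1)))"
    (is "_ = _ * ?S")
proof -
  let ?g = "gauss_sum p 1" and ?c = "of_int (Legendre (-1) (int p)) :: complex"
  let ?H = "zeta_pow p (of_int (k * t)) * F p t (zeta_pow p (of_int k + x))"
  have "(e x - 1) * ?S = ?c * ?g * ?H"
    using sum_eq_F [OF assms, of k t] by (simp add: sum_distrib_left mult_ac)
  then have "(e x - 1) / of_nat p * ?S = ?c * ?g * ?H / of_nat p"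
    by simp
  \<comment> \<open>Writing \<open>p\<close> as \<open>?c * ?g ^ 2\<close> lets the symbol of -1 and
    one Gauss sum cancel.\<close>
  also have "\<dots> = ?c * ?g * ?H / (?c * ?g ^ 2)"
    by (simp only: gauss_sum_square [OF assms(1,2)])
  also have "\<dots> = ?H / ?g"
  proof -
    have "?c \<noteq> 0" and "?g \<noteq> 0"
      using gauss_sum_square [OF assms(1,2)] assms(1) by auto
    then show ?thesis
      by (simp add: power2_eq_square)
  qed
  also have "\<dots> = G p t k x"
    by (simp add: G_eq [OF assms(1,2)])
  finally show ?thesis
    by simp
qed

end
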